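(* Let $\mathcal{T} = \{1, 2, 2^2, 2^3, \dots\} \subseteq \mathbb{Z}$. Then there exists an infinite subset $\mathcal{S}$ of $\mathbb{Z}_{\leq -1} = \{n \in \mathbb{Z} \mid n \leq -1\}$ such that $(\mathcal{S}, \mathcal{T})$ is a co-minimal pair in $\mathbb{Z}$.
   Context: For nonempty subsets $A, B$ of an abelian group $(G,+)$, write $A + B = \{a+b \mid a\in A, b\in B\}$. The pair $(A,B)$ is called a co-minimal pair in $G$ if $A + B = G$, $A' + B \subsetneq G$ for every $\emptyset \neq A' \subsetneq A$, and $A + B' \subsetneq G$ for every $\emptyset \neq B' \subsetneq B$. *)

theory Defs
  imports Main "HOL-Library.Set_Algebras"
begin

text \<open>The ambient group is the whole type, so \<^term>\<open>UNIV\<close> plays the role of $G$;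
  \<^term>\<open>A + B\<close> on sets is the elementwise sum from \<^theory>\<open>HOL-Library.Set_Algebras\<close>.\<close>

definition co_minimal_pair :: "'a::ab_group_add set \<Rightarrow> 'a set \<Rightarrow> bool" where
  "co_minimal_pair A B \<longleftrightarrow>
     A \<noteq> {} \<and> B \<noteq> {} \<and> A + B = UNIV \<and>
     (\<forall>A'. A' \<noteq> {} \<and> A' \<subset> A \<longrightarrow> A' + B \<subset> UNIV) \<and>
     (\<forall>B'. B' \<noteq> {} \<and> B' \<subset> B \<longrightarrow> A + B' \<subset> UNIV)"

end

theory Submission
  imports Defs
begin

text \<open>
  The set \<open>\<S>\<close> is built greedily. A pair \<open>(s, k)\<close> records the decision to put \<open>s\<close> into \<open>\<S>\<close> and to
  reserve the sum \<open>s + 2 ^ k\<close>: no other element of \<open>\<S>\<close> may reach that sum by adding a power of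
  two. If every element of \<open>\<S>\<close> takes part in such a pair, and every exponent does too, then no
  element of \<open>\<S>\<close> and no power of two can be dropped, since a reserved sum would be lost. So it
  suffices to collect pairs until every integer is covered and every exponent is used.

  Only finitely many sums are reserved at any stage, and the powers of two are so sparse that this
  leaves room. An uncovered integer \<open>n\<close> can be covered by \<open>n - 2 ^ k\<close> for any large \<open>k\<close>, because the
  distance from \<open>2 ^ k\<close> to the other powers grows with \<open>k\<close> (lemma \<open>extend_to_cover\<close>). An
  exponent \<open>k\<close> can be paired with \<open>- 3 * 2 ^ m\<close> for any large \<open>m\<close>, because \<open>3 * 2 ^ m\<close> is far
  from every power of two (lemma \<open>extend_to_use_exponent\<close>). Alternating the two steps and
  taking the union gives \<open>\<S>\<close>. It is infinite because a finite set plus the powers of two is bounded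
  below.
\<close>

definition reserving :: "(int \<times> nat) set \<Rightarrow> bool" where
  "reserving F \<longleftrightarrow> (\<forall>s k. (s, k) \<in> F \<longrightarrow>
     s < 0 \<and> (\<forall>s' \<in> fst ` F. \<forall>j. s' + 2 ^ j = s + 2 ^ k \<longrightarrow> s' = s))"

lemma reservingD:
  assumes "reserving F" "(s, k) \<in> F" "s' \<in> fst ` F" "s' + 2 ^ j = s + 2 ^ k"
  shows "s' = s" "j = k"
proof -
  show "s' = s" using assms unfolding reserving_def by blast
  then show "j = k" using assms(4) by simp
qed

lemma reservingI:
  assumes "\<And>s k. (s, k) \<in> F \<Longrightarrow> s < 0"
    and "\<And>s k s' j. (s, k) \<in> F \<Longrightarrow> s' \<in> fst ` F \<Longrightarrow> s' + 2 ^ j = s + 2 ^ k \<Longrightarrow> s' = s"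
  shows "reserving F"
  using assms unfolding reserving_def by blast

text \<open>
  The premise \<open>fresh\<close> protects the new sum from the old elements, and \<open>avoids\<close> protects the old sums
  from the new element.
\<close>
lemma reserving_insert:
  assumes "reserving F" "s < 0"
    and fresh: "\<And>s' j. s' \<in> fst ` F \<Longrightarrow> s' + 2 ^ j \<noteq> s + 2 ^ k"
    and avoids: "\<And>s' k' j. (s', k') \<in> F \<Longrightarrow> s + 2 ^ j \<noteq> s' + 2 ^ k'"
  shows "reserving (insert (s, k) F)"
proof (rule reservingI)
  show "s' < 0" if "(s', k') \<in> insert (s, k) F" for s' k'
    using assms(1,2) that unfolding reserving_def by blast
next
  fix s1 k1 s2 j
  assume s1: "(s1, k1) \<in> insert (s, k) F" and s2: "s2 \<in> fst ` insert (s, k) F"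
    and eq: "s2 + 2 ^ j = s1 + 2 ^ k1"
  show "s2 = s1"
  proof (cases "(s1, k1) \<in> F")
    case True
    have "s2 \<noteq> s" using avoids[OF True, of j] eq by blast
    then have "s2 \<in> fst ` F" using s2 by simp
    with True show ?thesis using reservingD(1)[OF assms(1)] eq by blast
  next
    case False
    then have "s1 = s" "k1 = k" using s1 by simp_all
    then have "s2 \<notin> fst ` F" using fresh eq by blast
    then show ?thesis using s2 \<open>s1 = s\<close> by simp
  qed
qed

text \<open>A conflict involves only two pairs, and in a chain both lie in a common member.\<close>
lemma reserving_Union_chain:
  assumes "\<And>i. reserving (F i)" "\<And>i. F i \<subseteq> F (Suc i)"
  shows "reserving (\<Union>i. F i)"
proof (rule reservingI)
  show "s < 0" if "(s, k) \<in> (\<Union>i. F i)" for s k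
    using assms(1) that unfolding reserving_def by blast
next
  fix s k s' j
  assume s: "(s, k) \<in> (\<Union>i. F i)" and s': "s' \<in> fst ` (\<Union>i. F i)"
    and eq: "s' + 2 ^ j = s + 2 ^ k"
  obtain a b where "(s, k) \<in> F a" "s' \<in> fst ` F b" using s s' by blast
  moreover have "F a \<subseteq> F (max a b)" "F b \<subseteq> F (max a b)"
    by (simp_all add: lift_Suc_mono_le[of F, OF assms(2)])
  ultimately have "(s, k) \<in> F (max a b)" "s' \<in> fst ` F (max a b)" by blast+
  then show "s' = s" using reservingD(1)[OF assms(1)] eq by blast
qed

lemma pow2_gap:
  fixes j k :: nat
  assumes "j \<noteq> k"
  shows "(2 :: int) ^ k \<le> 2 * \<bar>2 ^ k - 2 ^ j\<bar>"
proof -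
  have gap: "x \<le> 2 * \<bar>x - y\<bar>" if "0 < x" "2 * y \<le> x \<or> 2 * x \<le> y" for x y :: int
    using that by (auto simp: abs_if)
  have "Suc j \<le> k \<or> Suc k \<le> j" using assms by linarith
  then have "(2 :: int) ^ Suc j \<le> 2 ^ k \<or> (2 :: int) ^ Suc k \<le> 2 ^ j"
    by (metis power_increasing one_le_numeral)
  then show ?thesis by (intro gap) simp_all
qed

text \<open>The powers nearest to \<open>3 * 2 ^ m\<close> are \<open>2 ^ (m + 1)\<close> and \<open>2 ^ (m + 2)\<close>, both at distance \<open>2 ^ m\<close>.\<close>
lemma three_pow2_gap:
  fixes j m :: nat
  shows "(2 :: int) ^ m \<le> \<bar>3 * 2 ^ m - 2 ^ j\<bar>"
proof (cases "j \<le> Suc m")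
  case True
  then have "(2 :: int) ^ j \<le> 2 ^ Suc m" by (intro power_increasing) auto
  then show ?thesis by simp
next
  case False
  then have "(2 :: int) ^ Suc (Suc m) \<le> 2 ^ j" by (intro power_increasing) auto
  then show ?thesis by simp
qed

lemma finite_abs_bound:
  fixes X :: "int set"
  assumes "finite X"
  obtains M where "0 \<le> M" "\<And>x. x \<in> X \<Longrightarrow> \<bar>x\<bar> \<le> M"
proof
  show "0 \<le> (\<Sum>x\<in>X. \<bar>x\<bar>)" by (simp add: sum_nonneg)
  show "\<bar>x\<bar> \<le> (\<Sum>x\<in>X. \<bar>x\<bar>)" if "x \<in> X" for x
    using assms that by (intro member_le_sum) auto
qed

lemma pow2_exceeds: obtains k :: nat where "(x :: int) < 2 ^ k"
proof
  have "int (nat x) < int (2 ^ nat x)" unfolding of_nat_less_iff by (rule less_exp)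
  then show "x < 2 ^ nat x" by (simp split: if_splits)
qed

text \<open>
  The new element \<open>n - 2 ^ k\<close> would reach a reserved sum \<open>p\<close> only if \<open>n - p\<close> were a difference of
  two powers of two, one of them \<open>2 ^ k\<close>. Unless \<open>n\<close> is already covered, \<open>n \<noteq> p\<close>, so the powers differ and
  \<open>n - p\<close> is at least \<open>2 ^ k / 2\<close> in absolute value; a large \<open>k\<close> excludes this.
\<close>
lemma extend_to_cover:
  assumes "finite F" "reserving F"
  obtains F' where "finite F'" "reserving F'" "F \<subseteq> F'" "\<exists>s \<in> fst ` F'. \<exists>j. n = s + 2 ^ j"
proof (cases "\<exists>s \<in> fst ` F. \<exists>j. n = s + 2 ^ j")
  case True
  then show ?thesis using that[of F] assms by blast
next
  case False
  obtain M where M: "0 \<le> M" "\<And>x. x \<in> insert n ((\<lambda>(s, k). s + 2 ^ k) ` F) \<Longrightarrow> \<bar>x\<bar> \<le> M"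
    using finite_abs_bound[of "insert n ((\<lambda>(s, k). s + 2 ^ k) ` F)"] assms(1) by blast
  have n: "\<bar>n\<bar> \<le> M" using M(2) by simp
  have reserved: "\<bar>s + 2 ^ k\<bar> \<le> M" if "(s, k) \<in> F" for s k
    using M(2)[of "s + 2 ^ k"] that by force
  obtain k where k: "4 * M < 2 ^ k" using pow2_exceeds .
  have "reserving (insert (n - 2 ^ k, k) F)"
  proof (rule reserving_insert)
    show "reserving F" by fact
    show "n - 2 ^ k < 0" using n k M(1) by linarith
    show "s' + 2 ^ j \<noteq> n - 2 ^ k + 2 ^ k" if "s' \<in> fst ` F" for s' j
      using False that by (metis diff_add_cancel)
    show "n - 2 ^ k + 2 ^ j \<noteq> s' + 2 ^ k'" if F: "(s', k') \<in> F" for s' k' j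
    proof
      assume eq: "n - 2 ^ k + 2 ^ j = s' + 2 ^ k'"
      have "s' \<in> fst ` F" using F by force
      then have "j \<noteq> k" using False eq by auto
      then have "(2 :: int) ^ k \<le> 2 * \<bar>2 ^ k - 2 ^ j\<bar>" by (rule pow2_gap)
      also have "(2 :: int) ^ k - 2 ^ j = n - (s' + 2 ^ k')" using eq by simp
      also have "\<bar>n - (s' + 2 ^ k')\<bar> \<le> 2 * M"
        using abs_triangle_ineq4[of n "s' + 2 ^ k'"] n reserved[OF F] by simp
      finally show False using k by simp
    qed
  qed
  moreover have "n = (n - 2 ^ k) + 2 ^ k" by simp
  then have "\<exists>s \<in> fst ` insert (n - 2 ^ k, k) F. \<exists>j. n = s + 2 ^ j"
    unfolding image_insert fst_conv by blast
  ultimately show ?thesis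
    using assms(1) by (intro that[of "insert (n - 2 ^ k, k) F"])
      (simp_all only: finite_insert subset_insertI)
qed

text \<open>
  A very negative \<open>s\<close> makes \<open>s + 2 ^ k\<close> smaller than every element of \<open>F\<close>, hence uncovered. The
  form \<open>s = - 3 * 2 ^ m\<close> keeps \<open>s + 2 ^ j\<close> large in absolute value for all \<open>j\<close>, hence away from
  the finitely many reserved sums.
\<close>
lemma extend_to_use_exponent:
  assumes "finite F" "reserving F"
  obtains F' where "finite F'" "reserving F'" "F \<subseteq> F'" "\<exists>s. (s, k) \<in> F'"
proof -
  obtain M where M: "\<And>x. x \<in> (\<lambda>(s, k). s + 2 ^ k) ` F \<Longrightarrow> \<bar>x\<bar> \<le> M"
    using finite_abs_bound[of "(\<lambda>(s, k). s + 2 ^ k) ` F"] assms(1) by blast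
  have reserved: "\<bar>s + 2 ^ k\<bar> \<le> M" if "(s, k) \<in> F" for s k
    using M[of "s + 2 ^ k"] that by force
  obtain N where N: "0 \<le> N" "\<And>x. x \<in> fst ` F \<Longrightarrow> \<bar>x\<bar> \<le> N"
    using finite_abs_bound[of "fst ` F"] assms(1) by blast
  obtain m where m: "max M (N + 2 ^ k) < 2 ^ m" using pow2_exceeds .
  let ?s = "- 3 * 2 ^ m :: int"
  have "reserving (insert (?s, k) F)"
  proof (rule reserving_insert)
    show "reserving F" by fact
    show "?s < 0" by simp
    show "s' + 2 ^ j \<noteq> ?s + 2 ^ k" if "s' \<in> fst ` F" for s' j
    proof -
      have "(0 :: int) < 2 ^ j" "(0 :: int) < 2 ^ m" by simp_all
      then show ?thesis using N(2)[OF that] m by linarith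
    qed
    show "?s + 2 ^ j \<noteq> s' + 2 ^ k'" if "(s', k') \<in> F" for s' k' j
      using three_pow2_gap[of m j] reserved[OF that] m by linarith
  qed
  then show thesis
    using assms(1) by (intro that[of "insert (?s, k) F"]) auto
qed

lemma exists_saturated_reserving:
  obtains U where "reserving U" "\<And>n. \<exists>s \<in> fst ` U. \<exists>j. n = s + 2 ^ j" "\<And>k. \<exists>s. (s, k) \<in> U"
proof -
  \<comment> \<open>Stage \<open>i\<close> covers both \<open>i\<close> and \<open>- i\<close>, so every integer has its turn.\<close>
  let ?step = "\<lambda>i F F'. F \<subseteq> F' \<and> (\<exists>s \<in> fst ` F'. \<exists>j. int i = s + 2 ^ j) \<and>
    (\<exists>s \<in> fst ` F'. \<exists>j. - int i = s + 2 ^ j) \<and> (\<exists>s. (s, i) \<in> F')"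
  have "\<exists>F. \<forall>i. (finite (F i) \<and> reserving (F i)) \<and> ?step i (F i) (F (Suc i))"
  proof (rule dependent_nat_choice)
    show "\<exists>F. finite F \<and> reserving F"
      by (rule exI[of _ "{}"]) (simp add: reserving_def)
    fix F i assume F: "finite F \<and> reserving F"
    then obtain F1 where F1: "finite F1" "reserving F1" "F \<subseteq> F1"
        "\<exists>s \<in> fst ` F1. \<exists>j. int i = s + 2 ^ j"
      using extend_to_cover by metis
    obtain F2 where F2: "finite F2" "reserving F2" "F1 \<subseteq> F2"
        "\<exists>s \<in> fst ` F2. \<exists>j. - int i = s + 2 ^ j"
      using extend_to_cover[OF F1(1,2)] by metis
    obtain F3 where F3: "finite F3" "reserving F3" "F2 \<subseteq> F3" "\<exists>s. (s, i) \<in> F3"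
      using extend_to_use_exponent[OF F2(1,2)] by metis
    have sub: "F \<subseteq> F3" "fst ` F1 \<subseteq> fst ` F3" "fst ` F2 \<subseteq> fst ` F3"
      using F1(3) F2(3) F3(3) by blast+
    have "\<exists>s \<in> fst ` F3. \<exists>j. int i = s + 2 ^ j" using F1(4) sub(2) by (meson subsetD)
    moreover have "\<exists>s \<in> fst ` F3. \<exists>j. - int i = s + 2 ^ j"
      using F2(4) sub(3) by (meson subsetD)
    ultimately have "?step i F F3" using sub(1) F3(4) by (intro conjI)
    then show "\<exists>F'. (finite F' \<and> reserving F') \<and> ?step i F F'"
      using F3(1,2) by (intro exI[of _ F3]) simp
  qed
  then obtain F where F: "\<And>i. reserving (F i)" "\<And>i. ?step i (F i) (F (Suc i))" by blast
  show ?thesis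
  proof (rule that)
    show "reserving (\<Union>i. F i)" using F by (intro reserving_Union_chain) auto
    show "\<exists>s \<in> fst ` (\<Union>i. F i). \<exists>j. n = s + 2 ^ j" for n
    proof -
      have "\<exists>s \<in> fst ` F (Suc (nat \<bar>n\<bar>)). \<exists>j. n = s + 2 ^ j"
        using F(2)[of "nat \<bar>n\<bar>"] by (cases "0 \<le> n") auto
      then show ?thesis by blast
    qed
    show "\<exists>s. (s, k) \<in> (\<Union>i. F i)" for k
      using F(2)[of k] by blast
  qed
qed

text \<open>
  Minimality on either side needs only one witness per element: a reserved sum \<open>s + 2 ^ k\<close> has no
  other representation, so it is lost when \<open>s\<close> or \<open>2 ^ k\<close> is removed.
\<close>
lemma co_minimal_pair_of_saturated_reserving:
  assumes U: "reserving U" "\<And>n. \<exists>s \<in> fst ` U. \<exists>j. n = s + 2 ^ j" "\<And>k. \<exists>s. (s, k) \<in> U"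
  shows "co_minimal_pair (fst ` U) {2 ^ n | n :: nat. True}"
proof -
  let ?S = "fst ` U" and ?T = "{2 ^ n | n :: nat. True} :: int set"
  have lost: "s + 2 ^ k \<notin> A + B"
    if "(s, k) \<in> U" "A \<subseteq> ?S" "B \<subseteq> ?T" "s \<notin> A \<or> 2 ^ k \<notin> B" for s k A B
  proof
    assume "s + 2 ^ k \<in> A + B"
    then obtain a b where ab: "a \<in> A" "b \<in> B" "s + 2 ^ k = a + b"
      by (auto simp: set_plus_def)
    then obtain j where "b = 2 ^ j" using \<open>B \<subseteq> ?T\<close> by blast
    have "a \<in> ?S" using ab(1) \<open>A \<subseteq> ?S\<close> by blast
    moreover have "a + 2 ^ j = s + 2 ^ k" using ab(3) \<open>b = 2 ^ j\<close> by simp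
    ultimately have "a = s \<and> j = k" using reservingD[OF U(1) that(1)] by blast
    then show False using ab that(4) \<open>b = 2 ^ j\<close> by simp
  qed
  have "?S + ?T = UNIV"
  proof (intro UNIV_eq_I[symmetric])
    show "n \<in> ?S + ?T" for n using U(2)[of n] by (blast intro: set_plus_intro)
  qed
  moreover have "A' + ?T \<subset> UNIV" if A': "A' \<subset> ?S" for A'
  proof -
    obtain s k where "(s, k) \<in> U" "s \<notin> A'" using A' by force
    then show ?thesis using lost[of s k A' ?T] A' by blast
  qed
  moreover have "?S + B' \<subset> UNIV" if B': "B' \<subset> ?T" for B'
  proof -
    obtain k where k: "2 ^ k \<notin> B'" using B' by blast
    obtain s where "(s, k) \<in> U" using U(3) by blast
    then show ?thesis using lost[of s k ?S B'] B' k by blast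
  qed
  moreover have "?S \<noteq> {}" using U(2) by blast
  moreover have "?T \<noteq> {}" by blast
  ultimately show ?thesis unfolding co_minimal_pair_def by (intro conjI allI impI) simp_all
qed

theorem theorem1p1:
  fixes \<T> :: "int set"
  assumes "\<T> = {2 ^ n | n :: nat. True}"
  shows "\<exists>\<S> :: int set. infinite \<S> \<and> \<S> \<subseteq> {n. n \<le> -1} \<and> co_minimal_pair \<S> \<T>"
proof -
  obtain U where U: "reserving U" "\<And>n. \<exists>s \<in> fst ` U. \<exists>j. n = s + 2 ^ j"
      "\<And>k. \<exists>s. (s, k) \<in> U"
    by (rule exists_saturated_reserving) (rule that)
  have "infinite (fst ` U)"
  proof
    assume "finite (fst ` U)"
    then obtain M where M: "\<And>s. s \<in> fst ` U \<Longrightarrow> \<bar>s\<bar> \<le> M"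
      using finite_abs_bound by blast
    obtain s and j :: nat where s: "s \<in> fst ` U" "- M = s + 2 ^ j" using U(2) by blast
    have "(0 :: int) < 2 ^ j" by simp
    then show False using s(2) M[OF s(1)] by linarith
  qed
  moreover have "fst ` U \<subseteq> {n. n \<le> -1}"
    using U(1) by (force simp: reserving_def)
  moreover have "co_minimal_pair (fst ` U) \<T>"
    unfolding assms using U by (rule co_minimal_pair_of_saturated_reserving)
  ultimately show ?thesis by blast
qed

end
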